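(* Let $k\ge0$, let $\alpha$ be a state of the infinite state graph $G_\infty$, and let $\beta=\mathrm{FR}(\alpha)$. Let $A$ be the set of all walks of length $k$ in $G_\infty$ that pass through $\alpha$, and $B$ the set of all walks of length $k$ in $G_\infty$ that pass through $\beta$. Then there exists a bijection between $A$ and $B$.
   Context: Vertices of $G_\infty$ (states) are bi-infinite $0/1$ sequences $(x_i)_{i\in\mathbb{Z}}$ with $x_i=1$ for all sufficiently small $i$ and $x_i=0$ for all sufficiently large $i$, considered up to translation of indices. There is a transition $\gamma\to\delta$ iff $\delta$ is obtained from $\gamma$ by changing exactly one entry $0$ into $1$ (up to translation). A walk of length $k$ is a sequence of states $\gamma_0\to\gamma_1\to\cdots\to\gamma_k$ in which each consecutive pair is a transition; it passes through $\alpha$ if $\gamma_i=\alpha$ for some $i$. The flip-reverse map $\mathrm{FR}$ sends a state $(x_i)_{i\in\mathbb{Z}}$ to $(1-x_{-i})_{i\in\mathbb{Z}}$ (complement every digit, then reverse the order). *)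

theory Defs
  imports Main
begin

text \<open>
  The digits 0 and 1 are the truth values \<^const>\<open>False\<close> and \<^const>\<open>True\<close>, so that
  the complement of a digit is its negation.
\<close>

definition admissible :: "(int \<Rightarrow> bool) \<Rightarrow> bool" where
  "admissible x \<longleftrightarrow> (\<exists>m. \<forall>i<m. x i) \<and> (\<exists>n. \<forall>i>n. \<not> x i)"

definition translates :: "(int \<Rightarrow> bool) \<Rightarrow> (int \<Rightarrow> bool) \<Rightarrow> bool" where
  "translates x y \<longleftrightarrow> admissible x \<and> admissible y \<and> (\<exists>t. \<forall>i. y i = x (i + t))"

lemma translates_sym: "translates x y \<Longrightarrow> translates y x"
proof -
  assume "translates x y"
  then obtain t where t: "\<And>i. y i = x (i + t)" and adm: "admissible x" "admissible y"
    unfolding translates_def by blast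
  have "x i = y (i + (- t))" for i using t[of "i - t"] by simp
  then show ?thesis using adm unfolding translates_def by blast
qed

lemma translates_trans: "translates x y \<Longrightarrow> translates y z \<Longrightarrow> translates x z"
  unfolding translates_def by (metis (no_types, lifting) add.assoc)

lemma part_equivp_translates: "part_equivp translates"
proof (rule part_equivpI)
  have "admissible (\<lambda>i. i < 0)"
    unfolding admissible_def by (auto intro: exI[of _ 0])
  then show "\<exists>x. translates x x"
    unfolding translates_def by (metis add_0_right)
qed (auto intro!: sympI transpI intro: translates_sym translates_trans)

text \<open>
  The vertices of the infinite state graph: admissible sequences up to translation of
  indices.  The quotient is partial because sequences that are not admissible represent
  no state.
\<close>

quotient_type state = "int \<Rightarrow> bool" / partial: translates
  by (rule part_equivp_translates)

lift_definition transition :: "state \<Rightarrow> state \<Rightarrow> bool"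
  is "\<lambda>x y. \<exists>j. \<not> x j \<and> translates (x(j := True)) y"
proof -
  have imp: "\<exists>j. \<not> x' j \<and> translates (x'(j := True)) y'"
    if xx': "translates x x'" and yy': "translates y y'"
      and ex: "\<exists>j. \<not> x j \<and> translates (x(j := True)) y" for x x' y y'
  proof -
    from ex obtain j where j: "\<not> x j" "translates (x(j := True)) y" by blast
    from xx' obtain t where t: "\<And>i. x' i = x (i + t)" and adm: "admissible x'"
      unfolding translates_def by blast
    from adm obtain m n where mn: "\<And>i. i < m \<Longrightarrow> x' i" "\<And>i. i > n \<Longrightarrow> \<not> x' i"
      unfolding admissible_def by blast
    have "admissible (x'(j - t := True))"
      unfolding admissible_def
    proof
      show "\<exists>m. \<forall>i<m. (x'(j - t := True)) i" using mn by auto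
      show "\<exists>n. \<forall>i>n. \<not> (x'(j - t := True)) i"
        using mn by (intro exI[of _ "max n (j - t)"]) auto
    qed
    moreover have "(x'(j - t := True)) i = (x(j := True)) (i + t)" for i
      using t by auto
    ultimately have "translates (x(j := True)) (x'(j - t := True))"
      using j(2) unfolding translates_def by blast
    then have "translates (x'(j - t := True)) y'"
      using j(2) yy' by (blast intro: translates_sym translates_trans)
    moreover have "\<not> x' (j - t)" using j(1) t by simp
    ultimately show ?thesis by blast
  qed
  show "(\<exists>j. \<not> x j \<and> translates (x(j := True)) y) =
        (\<exists>j. \<not> x' j \<and> translates (x'(j := True)) y')"
    if "translates x x'" "translates y y'" for x x' y y'
    using imp[OF that] imp[OF that[THEN translates_sym]] by blast
qed

lift_definition FR :: "state \<Rightarrow> state"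
  is "\<lambda>x i. \<not> x (- i)"
proof -
  have adm: "admissible (\<lambda>i. \<not> x (- i))" if x: "admissible x" for x
  proof -
    from x obtain m n where mn: "\<And>i. i < m \<Longrightarrow> x i" "\<And>i. i > n \<Longrightarrow> \<not> x i"
      unfolding admissible_def by blast
    show ?thesis
      unfolding admissible_def
    proof
      show "\<exists>m. \<forall>i<m. \<not> x (- i)" using mn(2) by (intro exI[of _ "- n"]) auto
      show "\<exists>n. \<forall>i>n. \<not> \<not> x (- i)" using mn(1) by (intro exI[of _ "- m"]) auto
    qed
  qed
  show "translates (\<lambda>i. \<not> x (- i)) (\<lambda>i. \<not> y (- i))" if xy: "translates x y" for x y
  proof -
    from xy obtain t where t: "\<And>i. y i = x (i + t)"
      unfolding translates_def by blast
    have "(\<not> y (- i)) = (\<not> x (- (i + (- t))))" for i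
      using t[of "- i"] by simp
    then show ?thesis
      using xy adm unfolding translates_def by blast
  qed
qed

text \<open>
  A walk of length \<open>k\<close> is the list of its \<open>k + 1\<close> states.
\<close>

definition walks_through :: "nat \<Rightarrow> state \<Rightarrow> state list set" where
  "walks_through k \<alpha> = {w. length w = k + 1 \<and> successively transition w \<and> \<alpha> \<in> set w}"

end

theory Submission
  imports Defs
begin

text \<open>
  Flip-reverse turns the changed digit 0 into a digit 1 and conversely, so it reverses every
  transition; hence applying it to all states of a walk and reading the result backwards is an
  involution that exchanges the walks through a state with those through its flip-reverse.
\<close>

text \<open>Needed because \<open>translates\<close> demands admissibility on both sides: the two
  bounds of \<open>x\<close> move by \<open>t\<close>.\<close>

lemma translates_shift:
  assumes "admissible x"
  shows "translates x (\<lambda>i. x (i + t))"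
proof -
  from assms obtain m n where mn: "\<And>i. i < m \<Longrightarrow> x i" "\<And>i. i > n \<Longrightarrow> \<not> x i"
    unfolding admissible_def by blast
  have "admissible (\<lambda>i. x (i + t))"
    unfolding admissible_def
  proof
    show "\<exists>m. \<forall>i<m. x (i + t)" using mn(1) by (intro exI[of _ "m - t"]) auto
    show "\<exists>n. \<forall>i>n. \<not> x (i + t)" using mn(2) by (intro exI[of _ "n - t"]) auto
  qed
  with assms show ?thesis unfolding translates_def by blast
qed

lemma FR_FR [simp]: "FR (FR \<gamma>) = \<gamma>"
  by transfer simp

lemma transition_FR:
  assumes "transition \<gamma> \<delta>"
  shows "transition (FR \<delta>) (FR \<gamma>)"
  using assms
proof transfer
  fix x y
  assume xx: "translates x x" and "\<exists>j. \<not> x j \<and> translates (x(j := True)) y"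
  then obtain j t where j: "\<not> x j" and t: "\<And>i. y i = (x(j := True)) (i + t)"
    unfolding translates_def by blast
  \<comment> \<open>In the partial quotient, \<open>xx\<close> says that \<open>x\<close> represents
    a state; respectfulness of \<open>FR\<close> carries this over to the flipped sequence.\<close>
  have "admissible (\<lambda>i. \<not> x (- i))"
    using FR.rsp xx unfolding rel_fun_def translates_def by blast
  then have "translates (\<lambda>i. \<not> x (- i)) (\<lambda>i. \<not> x (- (i + (- t))))"
    by (rule translates_shift)
  \<comment> \<open>The new 1 of \<open>y\<close> sits at \<open>j - t\<close>, so after
    flip-reverse there is a 0 at \<open>t - j\<close>. Setting it to 1 restores the flip of the 0
    that \<open>x\<close> has at \<open>j\<close>.\<close>
  moreover have "(\<lambda>i. \<not> x (- (i + (- t)))) = (\<lambda>i. \<not> y (- i))(t - j := True)"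
    using j t by (auto simp: fun_eq_iff)
  ultimately have "translates ((\<lambda>i. \<not> y (- i))(t - j := True)) (\<lambda>i. \<not> x (- i))"
    by (simp add: translates_sym)
  moreover have "\<not> \<not> y (- (t - j))" using t by simp
  ultimately show "\<exists>j. \<not> \<not> y (- j) \<and>
      translates ((\<lambda>i. \<not> y (- i))(j := True)) (\<lambda>i. \<not> x (- i))"
    by blast
qed

lemma rev_map_FR_walks_through:
  assumes "w \<in> walks_through k \<alpha>"
  shows "rev (map FR w) \<in> walks_through k (FR \<alpha>)"
proof -
  \<comment> \<open>Pulling the walk condition on \<open>rev (map FR w)\<close> back to
    \<open>w\<close> gives this relation: \<open>rev\<close> swaps the arguments, \<open>map\<close>
    inserts \<open>FR\<close>.\<close>
  have "successively (\<lambda>\<gamma> \<delta>. transition (FR \<delta>) (FR \<gamma>)) w"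
    using assms by (auto simp: walks_through_def intro: successively_mono transition_FR)
  then show ?thesis
    using assms by (auto simp: walks_through_def successively_map)
qed

theorem theorem7p9:
  fixes k :: nat and \<alpha> \<beta> :: state and A B :: "state list set"
  assumes "\<beta> = FR \<alpha>"
    and "A = walks_through k \<alpha>"
    and "B = walks_through k \<beta>"
  shows "\<exists>f. bij_betw f A B"
proof
  let ?f = "\<lambda>w. rev (map FR w)"
  have inv: "?f (?f w) = w" for w
    by (simp add: rev_map comp_def)
  show "bij_betw ?f A B"
  proof (rule bij_betw_byWitness[where f' = ?f])
    show "?f ` A \<subseteq> B"
      using assms rev_map_FR_walks_through by blast
    \<comment> \<open>The lemma leads to walks through \<open>FR \<beta>\<close>, which is
      \<open>\<alpha>\<close> as \<open>FR\<close> is an involution.\<close>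
    show "?f ` B \<subseteq> A"
      using assms rev_map_FR_walks_through[of _ k \<beta>] by auto
  qed (use inv in blast)+
qed

end
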